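(* Let $g(x)$ be a symmetric polynomial of degree $n\ge 1$ with complex coefficients and let $g_{\delta}(x)=\frac{n}{2}g(x)-xg'(x)$. If the Hermitian form $$\mathfrak{K}[g;x_0,x_1,\ldots,x_{n-1}]=\left[\frac{g(x)\overline{g}_{\delta}(y)+g_{\delta}(x)\overline{g}(y)}{1-xy}\right]_n$$ has $\pi$ positive squared terms and $\nu$ negative squared terms, then $g(x)$ has exactly $\pi-\nu$ distinct roots of absolute value $1$ and exactly $\nu$ distinct pairs of roots $\beta,\beta^{*}$ (with $\beta^{*}=1/\overline{\beta}$, $|\beta|\neq 1$) symmetric with respect to the circle $|x|=1$.
   Context: For a polynomial $f$, $\overline{f}$ denotes the polynomial whose coefficients are the complex conjugates of those of $f$ (so $\overline{g}_\delta$ is the coefficientwise conjugate of $g_\delta$). A polynomial $g(x)=a_0+a_1x+\dots+a_nx^n$ of degree $n$ is called symmetric if $g(x)=x^n\overline{g}(1/x)$, i.e. $a_k=\overline{a}_{n-k}$ for all $k$ (in particular $a_0=\overline{a}_n\ne0$). Together with any root $\beta$ with $|\beta|\neq 1$, such $g$ also has the root $\beta^*=1/\overline\beta$ with the same multiplicity. For an expression $P(x,y)=\sum_{i,k}p_{ik}x^iy^k$ with $p_{ki}=\overline{p}_{ik}$, the symbol $[P(x,y)]_n$ denotes the Hermitian form $\sum_{i,k=0}^{n-1}p_{ik}x_i\overline{x}_k$ in complex variables $x_0,\dots,x_{n-1}$. For symmetric $g$, the quotient in the bracket above is a polynomial in $x$ and $y$ of degree at most $n-1$ in each variable. The numbers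 $\pi$ and $\nu$ of positive and negative squared terms of a Hermitian form are the numbers of positive and negative coefficients in any representation of it as a real linear combination of squared absolute values of linearly independent linear forms (i.e. the numbers of positive and negative eigenvalues of its matrix). *)

theory Defs
  imports Complex_Main "HOL-Computational_Algebra.Polynomial"
begin

definition conj_poly :: "complex poly \<Rightarrow> complex poly" where
  "conj_poly f = map_poly cnj f"

text \<open>\<^const>\<open>reflect_poly\<close> sends \<open>f\<close> of degree \<open>n\<close> to \<open>x\<^sup>n f(1/x)\<close>.\<close>

definition symmetric_poly :: "complex poly \<Rightarrow> bool" where
  "symmetric_poly g \<longleftrightarrow> g \<noteq> 0 \<and> g = reflect_poly (conj_poly g)"

definition delta_poly :: "complex poly \<Rightarrow> complex poly" where
  "delta_poly g = smult (of_nat (degree g) / 2) g - [:0, 1:] * pderiv g"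

text \<open>Polynomials in \<open>x\<close> and \<open>y\<close> are represented as polynomials in \<open>y\<close> whose
  coefficients are polynomials in \<open>x\<close>.\<close>

definition in_x :: "complex poly \<Rightarrow> complex poly poly" where
  "in_x f = [:f:]"

definition in_y :: "complex poly \<Rightarrow> complex poly poly" where
  "in_y f = map_poly (\<lambda>c. [:c:]) f"

definition coeff_xy :: "complex poly poly \<Rightarrow> nat \<Rightarrow> nat \<Rightarrow> complex" where
  "coeff_xy P i k = coeff (coeff P k) i"

text \<open>The form \<open>[P(x,y)]\<^sub>n\<close>. Only the variables \<open>z 0, \<dots>, z (n - 1)\<close> matter. Its values are
  real when \<open>P\<close> is Hermitian, that is, \<open>coeff_xy P k i = cnj (coeff_xy P i k)\<close>.\<close>

definition herm_form :: "nat \<Rightarrow> complex poly poly \<Rightarrow> (nat \<Rightarrow> complex) \<Rightarrow> complex" where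
  "herm_form n P z = (\<Sum>i<n. \<Sum>k<n. coeff_xy P i k * z i * cnj (z k))"

text \<open>For symmetric \<open>g\<close>, the numerator is divisible by \<open>1 - x y\<close>: the substitution \<open>y = 1/x\<close>
  turns it into \<open>0\<close>, because \<open>x\<^sup>n\<close> times the conjugate of \<open>delta_poly g\<close> at \<open>1/x\<close> is
  \<open>- delta_poly g\<close>. So the \<open>div\<close> below is an exact quotient of bivariate polynomials.\<close>

definition K_quotient :: "complex poly \<Rightarrow> complex poly poly" where
  "K_quotient g =
     (in_x g * in_y (conj_poly (delta_poly g)) + in_x (delta_poly g) * in_y (conj_poly g))
     div (1 - in_x [:0, 1:] * in_y [:0, 1:])"

definition K_form :: "complex poly \<Rightarrow> (nat \<Rightarrow> complex) \<Rightarrow> complex" where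
  "K_form g = herm_form (degree g) (K_quotient g)"

definition lin_form :: "nat \<Rightarrow> (nat \<Rightarrow> complex) \<Rightarrow> (nat \<Rightarrow> complex) \<Rightarrow> complex" where
  "lin_form n l z = (\<Sum>i<n. l i * z i)"

definition lin_indep_forms :: "nat \<Rightarrow> nat \<Rightarrow> (nat \<Rightarrow> nat \<Rightarrow> complex) \<Rightarrow> bool" where
  "lin_indep_forms n m l \<longleftrightarrow>
     (\<forall>a. (\<forall>z. (\<Sum>j<m. a j * lin_form n (l j) z) = 0) \<longrightarrow> (\<forall>j<m. a j = 0))"

text \<open>\<open>H\<close>, a form in \<open>n\<close> variables, has some representation as a real linear combination of
  squared absolute values of linearly independent linear forms, with \<open>p\<close> positive and \<open>q\<close>
  negative coefficients. By the law of inertia \<open>p\<close> and \<open>q\<close> do not depend on the representation.\<close>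

definition has_squared_terms ::
  "nat \<Rightarrow> ((nat \<Rightarrow> complex) \<Rightarrow> complex) \<Rightarrow> nat \<Rightarrow> nat \<Rightarrow> bool" where
  "has_squared_terms n H p q \<longleftrightarrow>
     (\<exists>m (c :: nat \<Rightarrow> real) l.
        lin_indep_forms n m l \<and>
        (\<forall>z. H z = complex_of_real (\<Sum>j<m. c j * (cmod (lin_form n (l j) z))\<^sup>2)) \<and>
        card {j. j < m \<and> c j > 0} = p \<and>
        card {j. j < m \<and> c j < 0} = q)"

definition circle_reflect :: "complex \<Rightarrow> complex" where
  "circle_reflect \<beta> = 1 / cnj \<beta>"

end

theory Submission
  imports Defs "HOL-Computational_Algebra.Fundamental_Theorem_Algebra"
begin

text \<open>
  Let \<open>\<beta>\<close> range over the distinct roots of \<open>g\<close>, with multiplicities \<open>m\<^sub>\<beta>\<close>, and put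
  \<open>L\<^sub>\<beta> = g / (x - \<beta>)\<close>. Logarithmic differentiation gives
  \<open>g\<^sub>\<delta> = - 1/2 \<Sum> m\<^sub>\<beta> (x + \<beta>) L\<^sub>\<beta>\<close>. Reindexing the conjugate of this sum by \<open>\<beta> \<mapsto> \<beta>*\<close>
  turns the quotient into \<open>\<Sum> m\<^sub>\<beta> L\<^sub>\<beta>(x) M\<^sub>\<beta>(y)\<close>, where \<open>M\<^sub>\<beta>\<close> is the conjugate of
  \<open>L\<close> at \<open>\<beta>*\<close>. The \<open>L\<^sub>\<beta>\<close> are linearly independent, a root on the circle contributes one
  positive square, and by polarization a pair \<open>\<beta>, \<beta>*\<close> contributes one positive and one
  negative square. The law of inertia concludes.
\<close>

section \<open>The law of inertia\<close>

text \<open>Gaussian elimination, by induction on the equations: equation \<open>b\<close> is either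
  void or can be solved for one unknown \<open>p\<close>, which is then eliminated from the
  others.\<close>

lemma underdetermined_system_nontrivial_solution:
  fixes M :: "'b \<Rightarrow> 'a \<Rightarrow> 'c :: field"
  assumes "finite B" "finite A" "card B < card A"
  shows "\<exists>a. (\<exists>i\<in>A. a i \<noteq> 0) \<and> (\<forall>j\<in>B. (\<Sum>i\<in>A. M j i * a i) = 0)"
  using assms
proof (induction B arbitrary: A M rule: finite_induct)
  case empty
  then have "A \<noteq> {}" by auto
  then show ?case by (intro exI[of _ "\<lambda>_. 1"]) auto
next
  case (insert b B)
  show ?case
  proof (cases "\<forall>i\<in>A. M b i = 0")
    case True
    from insert have "card B < card A" by simp
    with insert.IH[of A M] insert.prems obtain a
      where "\<exists>i\<in>A. a i \<noteq> 0" "\<forall>j\<in>B. (\<Sum>i\<in>A. M j i * a i) = 0" by blast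
    with True show ?thesis by (intro exI[of _ a]) auto
  next
    case False
    then obtain p where p: "p \<in> A" "M b p \<noteq> 0" by blast
    define A' where "A' = A - {p}"
    have A: "A = insert p A'" "p \<notin> A'" "finite A'"
      using p insert.prems by (auto simp: A'_def)
    have "card B < card A'" using A insert by simp
    \<comment> \<open>These are the coefficients left after eliminating the unknown \<open>p\<close>
      by means of equation \<open>b\<close>.\<close>
    with insert.IH[of A' "\<lambda>j i. M j i - M j p * M b i / M b p"] A obtain a where
      a: "\<exists>i\<in>A'. a i \<noteq> 0"
         "\<forall>j\<in>B. (\<Sum>i\<in>A'. (M j i - M j p * M b i / M b p) * a i) = 0" by blast
    \<comment> \<open>Back substitution: equation \<open>b\<close> forces this value of the unknown
      \<open>p\<close>.\<close>
    define s where "s = - (\<Sum>i\<in>A'. M b i * a i) / M b p"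
    define a' where "a' = a(p := s)"
    have eq: "(\<Sum>i\<in>A. M j i * a' i) = M j p * s + (\<Sum>i\<in>A'. M j i * a i)" for j
    proof -
      have "(\<Sum>i\<in>A'. M j i * a' i) = (\<Sum>i\<in>A'. M j i * a i)"
        using A by (intro sum.cong) (auto simp: a'_def)
      then show ?thesis using A by (simp add: a'_def)
    qed
    have "(\<Sum>i\<in>A. M b i * a' i) = 0"
      unfolding eq s_def using p by simp
    moreover have "(\<Sum>i\<in>A. M j i * a' i) = 0" if "j \<in> B" for j
    proof -
      have "0 = (\<Sum>i\<in>A'. (M j i - M j p * M b i / M b p) * a i)" using a that by simp
      also have "\<dots> = (\<Sum>i\<in>A'. M j i * a i) - (\<Sum>i\<in>A'. M j p / M b p * (M b i * a i))"
        by (simp add: sum_subtractf algebra_simps)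
      also have "\<dots> = (\<Sum>i\<in>A'. M j i * a i) - M j p / M b p * (\<Sum>i\<in>A'. M b i * a i)"
        by (simp only: sum_distrib_left)
      also have "\<dots> = (\<Sum>i\<in>A. M j i * a' i)"
        unfolding eq s_def by simp
      finally show ?thesis by simp
    qed
    moreover have "\<exists>i\<in>A. a' i \<noteq> 0" using a A by (auto simp: a'_def)
    ultimately show ?thesis by blast
  qed
qed

lemma lin_form_sum_right:
  "lin_form n l (\<lambda>t. \<Sum>i\<in>A. a i * e i t) = (\<Sum>i\<in>A. a i * lin_form n l (e i))"
  unfolding lin_form_def sum_distrib_left
  by (subst sum.swap) (simp add: algebra_simps)

lemma lin_form_add_right:
  "lin_form n l (\<lambda>t. u t + v t) = lin_form n l u + lin_form n l v"
  by (simp add: lin_form_def algebra_simps sum.distrib)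

lemma lin_form_diff_right:
  "lin_form n l (\<lambda>t. u t - v t) = lin_form n l u - lin_form n l v"
  by (simp add: lin_form_def algebra_simps sum_subtractf)

lemma lin_form_scale_right:
  "lin_form n l (\<lambda>t. c * u t) = c * lin_form n l u"
  by (simp add: lin_form_def algebra_simps sum_distrib_left)

lemma lin_form_divide_right:
  "lin_form n l (\<lambda>t. u t / c) = lin_form n l u / c"
  by (simp add: lin_form_def sum_divide_distrib)

lemma lin_form_add_left:
  "lin_form n (\<lambda>t. k t + l t) u = lin_form n k u + lin_form n l u"
  by (simp add: lin_form_def algebra_simps sum.distrib)

lemma lin_form_diff_left:
  "lin_form n (\<lambda>t. k t - l t) u = lin_form n k u - lin_form n l u"
  by (simp add: lin_form_def algebra_simps sum_subtractf)

text \<open>Turns independence into vectors on which the forms take prescribed values. Forms are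
  added one at a time: independence yields a vector killed by the old forms but not by the new one,
  and this vector corrects the old dual vectors.\<close>

lemma dual_vectors_exist:
  assumes "finite A"
    and "\<And>a. (\<And>z. (\<Sum>j\<in>A. a j * lin_form n (l j) z) = 0) \<Longrightarrow> \<forall>j\<in>A. a j = 0"
  shows "\<exists>e. \<forall>i\<in>A. \<forall>j\<in>A. lin_form n (l j) (e i) = of_bool (i = j)"
  using assms
proof (induction A rule: finite_induct)
  case empty
  then show ?case by simp
next
  case (insert p A)
  have "\<forall>j\<in>A. a j = 0" if a: "\<And>z. (\<Sum>j\<in>A. a j * lin_form n (l j) z) = 0" for a
  proof -
    have "(\<Sum>j\<in>A. (a(p := 0)) j * lin_form n (l j) z) = 0" for z
      using insert.hyps a[of z] by (subst sum.cong[OF refl, where h = "\<lambda>j. a j * lin_form n (l j) z"]) auto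
    then have "\<forall>j\<in>insert p A. (a(p := 0)) j = 0"
      using insert.hyps by (intro insert.prems) simp
    then show ?thesis using insert.hyps by (metis fun_upd_other insertI2)
  qed
  from insert.IH[OF this] obtain e where
    e: "\<And>i j. i \<in> A \<Longrightarrow> j \<in> A \<Longrightarrow> lin_form n (l j) (e i) = of_bool (i = j)" by blast
  \<comment> \<open>With these coefficients the combination at \<open>z\<close> equals
    \<open>- lin_form n (l p) w\<close> for the \<open>w\<close> defined below, so a nonzero value
    shows that \<open>l p\<close> does not vanish at \<open>w\<close>.\<close>
  define a where "a = (\<lambda>j. if j = p then - 1 else lin_form n (l p) (e j))"
  have "\<not> (\<forall>j\<in>insert p A. a j = 0)" by (auto simp: a_def)
  then obtain z where z: "(\<Sum>j\<in>insert p A. a j * lin_form n (l j) z) \<noteq> 0"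
    using insert.prems by blast
  \<comment> \<open>Subtracting the components of \<open>z\<close> along the old dual vectors lands
    in the common kernel of the old forms.\<close>
  define w where "w = (\<lambda>t. z t - (\<Sum>i\<in>A. lin_form n (l i) z * e i t))"
  have w: "lin_form n f w = lin_form n f z - (\<Sum>i\<in>A. lin_form n (l i) z * lin_form n f (e i))" for f
    unfolding w_def lin_form_diff_right lin_form_sum_right ..
  have w0: "lin_form n (l j) w = 0" if "j \<in> A" for j
    using that insert.hyps by (simp add: w e if_distrib sum.delta cong: sum.cong if_cong)
  have "(\<Sum>j\<in>A. a j * lin_form n (l j) z) = (\<Sum>i\<in>A. lin_form n (l i) z * lin_form n (l p) (e i))"
    using insert.hyps by (intro sum.cong) (auto simp: a_def)
  with z insert.hyps have wp: "lin_form n (l p) w \<noteq> 0"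
    by (simp add: w a_def)
  define w' where "w' = (\<lambda>t. (1 / lin_form n (l p) w) * w t)"
  have w'0: "lin_form n (l j) w' = 0" if "j \<in> A" for j
    unfolding w'_def lin_form_scale_right w0[OF that] by simp
  have w'1: "lin_form n (l p) w' = 1"
    unfolding w'_def lin_form_scale_right using wp by simp
  \<comment> \<open>Subtracting a multiple of \<open>w'\<close> makes \<open>l p\<close> vanish and
    leaves the old forms unchanged, since they vanish at \<open>w'\<close>.\<close>
  define e' where "e' = (\<lambda>i. if i = p then w' else (\<lambda>t. e i t - lin_form n (l p) (e i) * w' t))"
  have "lin_form n (l j) (e' i) = of_bool (i = j)" if "i \<in> insert p A" "j \<in> insert p A" for i j
    using that insert.hyps
    by (auto simp: e'_def lin_form_diff_right lin_form_scale_right w'0 w'1 e)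
  then show ?case by blast
qed

text \<open>Sylvester's argument: on the span of the dual vectors with \<open>c j > 0\<close> the
  left side is positive definite. If \<open>d\<close> had fewer positive coefficients than
  \<open>c\<close>, some nonzero vector of that span would annihilate every form with
  \<open>d j > 0\<close>, making the right side nonpositive.\<close>

lemma inertia_le:
  assumes "finite A" "finite B"
    and dual: "\<And>i j. i \<in> A \<Longrightarrow> j \<in> A \<Longrightarrow> lin_form n (l j) (e i) = of_bool (i = j)"
    and eq: "\<And>z. (\<Sum>j\<in>A. c j * (cmod (lin_form n (l j) z))\<^sup>2)
                = (\<Sum>j\<in>B. d j * (cmod (lin_form n (k j) z))\<^sup>2)"
  shows "card {j\<in>A. c j > (0::real)} \<le> card {j\<in>B. d j > (0::real)}"
proof (rule ccontr)
  define P where "P = {j\<in>A. c j > 0}"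
  define Q where "Q = {j\<in>B. d j > 0}"
  assume "\<not> ?thesis"
  then have "card Q < card P" by (simp add: P_def Q_def)
  moreover have fin: "finite P" "finite Q" using assms by (auto simp: P_def Q_def)
  ultimately obtain a where a: "\<exists>i\<in>P. a i \<noteq> 0"
      "\<forall>j\<in>Q. (\<Sum>i\<in>P. lin_form n (k j) (e i) * a i) = 0"
    using underdetermined_system_nontrivial_solution[of Q P "\<lambda>j i. lin_form n (k j) (e i)"] by blast
  define z where "z = (\<lambda>t. \<Sum>i\<in>P. a i * e i t)"
  have z: "lin_form n f z = (\<Sum>i\<in>P. a i * lin_form n f (e i))" for f
    unfolding z_def by (rule lin_form_sum_right)
  have lz: "lin_form n (l j) z = (if j \<in> P then a j else 0)" if "j \<in> A" for j
  proof -
    have "lin_form n (l j) z = (\<Sum>i\<in>P. if i = j then a i else 0)"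
      unfolding z using that by (intro sum.cong) (auto simp: P_def dual)
    then show ?thesis using fin by simp
  qed
  have "0 < (\<Sum>j\<in>P. c j * (cmod (a j))\<^sup>2)"
  proof -
    from a obtain i where i: "i \<in> P" "a i \<noteq> 0" by blast
    show ?thesis
      by (rule sum_pos2[OF fin(1) i(1)]) (use i in \<open>auto simp: P_def\<close>)
  qed
  also have "\<dots> = (\<Sum>j\<in>A. c j * (cmod (lin_form n (l j) z))\<^sup>2)"
    by (rule sum.mono_neutral_cong_left) (use assms(1) lz in \<open>auto simp: P_def\<close>)
  also have "\<dots> = (\<Sum>j\<in>B. d j * (cmod (lin_form n (k j) z))\<^sup>2)" by (rule eq)
  also have "\<dots> \<le> 0"
  proof (rule sum_nonpos)
    fix j assume j: "j \<in> B"
    show "d j * (cmod (lin_form n (k j) z))\<^sup>2 \<le> 0"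
    proof (cases "j \<in> Q")
      case True
      then have "lin_form n (k j) z = 0" using a by (simp add: z mult.commute)
      then show ?thesis by simp
    next
      case False
      with j have "d j \<le> 0" by (auto simp: Q_def)
      then show ?thesis by (simp add: mult_nonpos_nonneg)
    qed
  qed
  finally show False by simp
qed

text \<open>The inequality is used in both directions, and again with all coefficients negated. The
  two index types may differ: below, one family is indexed by numbers and the other by
  roots.\<close>

lemma law_of_inertia:
  assumes "finite A" "finite B"
    and "\<And>i j. i \<in> A \<Longrightarrow> j \<in> A \<Longrightarrow> lin_form n (l j) (e i) = of_bool (i = j)"
    and "\<And>i j. i \<in> B \<Longrightarrow> j \<in> B \<Longrightarrow> lin_form n (k j) (f i) = of_bool (i = j)"
    and eq: "\<And>z. (\<Sum>j\<in>A. c j * (cmod (lin_form n (l j) z))\<^sup>2)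
                = (\<Sum>j\<in>B. d j * (cmod (lin_form n (k j) z))\<^sup>2)"
  shows "card {j\<in>A. c j > (0::real)} = card {j\<in>B. d j > (0::real)}"
    and "card {j\<in>A. c j < 0} = card {j\<in>B. d j < 0}"
proof -
  have eq': "(\<Sum>j\<in>A. - c j * (cmod (lin_form n (l j) z))\<^sup>2)
           = (\<Sum>j\<in>B. - d j * (cmod (lin_form n (k j) z))\<^sup>2)" for z
    using eq[of z] by (simp add: sum_negf)
  show "card {j\<in>A. c j > 0} = card {j\<in>B. d j > 0}"
    using inertia_le[OF assms(1,2,3) eq] inertia_le[OF assms(2,1,4) eq[symmetric]] by simp
  show "card {j\<in>A. c j < 0} = card {j\<in>B. d j < 0}"
    using inertia_le[OF assms(1,2,3) eq'] inertia_le[OF assms(2,1,4) eq'[symmetric]] by simp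
qed

section \<open>Polynomials in two variables\<close>

lemma coeff_conj_poly [simp]: "coeff (conj_poly f) i = cnj (coeff f i)"
  by (simp add: conj_poly_def coeff_map_poly)

lemma conj_poly_sum: "conj_poly (\<Sum>i\<in>A. f i) = (\<Sum>i\<in>A. conj_poly (f i))"
  by (simp add: poly_eq_iff coeff_sum)

lemma conj_poly_mult: "conj_poly (f * h) = conj_poly f * conj_poly h"
  by (simp add: poly_eq_iff coeff_mult)

lemma conj_poly_smult: "conj_poly (smult c f) = smult (cnj c) (conj_poly f)"
  by (simp add: poly_eq_iff)

lemma conj_poly_pCons: "conj_poly (pCons c f) = pCons (cnj c) (conj_poly f)"
  by (simp add: poly_eq_iff coeff_pCons split: nat.splits)

lemma conj_poly_0 [simp]: "conj_poly 0 = 0"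
  by (simp add: poly_eq_iff)

lemma conj_poly_power: "conj_poly (f ^ m) = conj_poly f ^ m"
proof (induction m)
  case 0
  then show ?case by (simp add: conj_poly_pCons one_pCons)
next
  case (Suc m)
  then show ?case by (simp add: conj_poly_mult)
qed

lemma coeff_in_y [simp]: "coeff (in_y f) k = [:coeff f k:]"
  by (simp add: in_y_def coeff_map_poly)

lemma sum_const_poly: "(\<Sum>i\<in>A. [:f i:]) = [:\<Sum>i\<in>A. f i:]"
  by (induction A rule: infinite_finite_induct) auto

lemma in_y_sum: "in_y (\<Sum>i\<in>A. f i) = (\<Sum>i\<in>A. in_y (f i))"
  by (intro poly_eqI) (simp add: coeff_sum sum_const_poly)

lemma in_y_mult: "in_y (f * h) = in_y f * in_y h"
  by (intro poly_eqI) (simp add: coeff_mult sum_const_poly mult.commute)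

lemma in_x_mult: "in_x (f * h) = in_x f * in_x h"
  by (simp add: in_x_def)

lemma in_x_sum: "in_x (\<Sum>i\<in>A. f i) = (\<Sum>i\<in>A. in_x (f i))"
  by (simp add: in_x_def sum_const_poly)

lemma coeff_xy_in_x_in_y: "coeff_xy (in_x f * in_y h) i k = coeff f i * coeff h k"
  by (simp add: coeff_xy_def in_x_def)

lemma coeff_xy_sum: "coeff_xy (\<Sum>a\<in>A. P a) i k = (\<Sum>a\<in>A. coeff_xy (P a) i k)"
  by (simp add: coeff_xy_def coeff_sum)

text \<open>The matrix of f(x) times the conjugate of h at y has entries
  \<open>coeff f i * cnj (coeff h k)\<close>, so the double sum factors into a linear form times a
  conjugated one.\<close>

lemma herm_form_sum_rank_one:
  "herm_form n (\<Sum>a\<in>A. in_x (smult (c a) (f a)) * in_y (conj_poly (h a))) z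
   = (\<Sum>a\<in>A. c a * lin_form n (coeff (f a)) z * cnj (lin_form n (coeff (h a)) z))"
proof -
  have "herm_form n (\<Sum>a\<in>A. in_x (smult (c a) (f a)) * in_y (conj_poly (h a))) z
    = (\<Sum>i<n. \<Sum>k<n. \<Sum>a\<in>A. c a * (coeff (f a) i * z i) * cnj (coeff (h a) k * z k))"
    by (simp add: herm_form_def coeff_xy_sum coeff_xy_in_x_in_y sum_distrib_right) (simp add: ac_simps)
  also have "\<dots> = (\<Sum>a\<in>A. \<Sum>i<n. \<Sum>k<n. c a * (coeff (f a) i * z i) * cnj (coeff (h a) k * z k))"
    by (subst sum.swap[of _ A]) (rule sum.swap)
  also have "\<dots> = (\<Sum>a\<in>A. c a * lin_form n (coeff (f a)) z * cnj (lin_form n (coeff (h a)) z))"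
    by (simp add: lin_form_def sum_product mult.assoc) (simp only: sum_distrib_left mult.assoc)
  finally show ?thesis .
qed

section \<open>Roots of a symmetric polynomial\<close>

text \<open>This includes 0, because division by zero gives
  \<open>circle_reflect 0 = 0\<close>.\<close>

lemma circle_reflect_involution [simp]: "circle_reflect (circle_reflect \<beta>) = \<beta>"
  by (simp add: circle_reflect_def)

lemma cmod_circle_reflect: "cmod (circle_reflect \<beta>) = 1 / cmod \<beta>"
  by (simp add: circle_reflect_def norm_divide)

text \<open>The origin is excluded because the convention 1/0 = 0 makes it a fixed point off the
  circle.\<close>

lemma circle_reflect_fixed_iff: "\<beta> \<noteq> 0 \<Longrightarrow> circle_reflect \<beta> = \<beta> \<longleftrightarrow> cmod \<beta> = 1"
proof -
  assume "\<beta> \<noteq> 0"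
  then have "circle_reflect \<beta> = \<beta> \<longleftrightarrow> \<beta> * cnj \<beta> = 1"
    by (auto simp: circle_reflect_def field_simps)
  also have "\<dots> \<longleftrightarrow> (cmod \<beta>)\<^sup>2 = 1"
    by (metis complex_norm_square of_real_1 of_real_eq_iff)
  finally show ?thesis by (simp add: power2_eq_1_iff) (metis norm_not_less_zero neg_less_0_iff_less zero_less_one)
qed

lemma symmetric_poly_coeff_0: "symmetric_poly g \<Longrightarrow> coeff g 0 \<noteq> 0"
proof -
  assume g: "symmetric_poly g"
  then have "conj_poly g \<noteq> 0" by (auto simp: symmetric_poly_def)
  moreover have "coeff g 0 = lead_coeff (conj_poly g)"
    using g unfolding symmetric_poly_def by (metis coeff_0_reflect_poly)
  ultimately show ?thesis by (metis leading_coeff_0_iff)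
qed

text \<open>Conjugating and then reversing the coefficients preserves divisibility, fixes
  \<open>g\<close>, and sends x - \<beta> to a nonzero multiple of x - \<beta>*. Since reflection is
  an involution, this inequality yields equality.\<close>

lemma order_circle_reflect_le:
  assumes "symmetric_poly g" "\<beta> \<noteq> 0"
  shows "order \<beta> g \<le> order (circle_reflect \<beta>) g"
proof -
  define b where "b = cnj \<beta>"
  have b: "b \<noteq> 0" "circle_reflect \<beta> = 1 / b" using assms by (auto simp: b_def circle_reflect_def)
  have "[:-\<beta>, 1:] ^ order \<beta> g dvd g" by (rule order_1)
  then have "conj_poly ([:-\<beta>, 1:] ^ order \<beta> g) dvd conj_poly g"
    by (metis dvd_def conj_poly_mult)
  then have "[:-b, 1:] ^ order \<beta> g dvd conj_poly g"
    by (simp add: conj_poly_power conj_poly_pCons b_def)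
  then have "reflect_poly ([:-b, 1:] ^ order \<beta> g) dvd reflect_poly (conj_poly g)"
    by (metis dvd_def reflect_poly_mult)
  then have "reflect_poly [:-b, 1:] ^ order \<beta> g dvd g"
    using assms by (simp add: reflect_poly_power symmetric_poly_def)
  \<comment> \<open>Reversing x - b gives 1 - b x = -b (x - 1/b).\<close>
  moreover have "reflect_poly [:-b, 1:] = smult (-b) [:- (1 / b), 1:]"
    using b by (simp add: reflect_poly_def)
  ultimately have "smult ((-b) ^ order \<beta> g) ([:- (1 / b), 1:] ^ order \<beta> g) dvd g"
    by (simp only: smult_power)
  then have "[:- (1 / b), 1:] ^ order \<beta> g dvd g"
    using b by (simp only: smult_dvd_iff power_eq_0_iff neg_equal_0_iff_equal) simp
  then show ?thesis
    using assms b unfolding symmetric_poly_def by (metis order_divides)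
qed

lemma order_circle_reflect:
  assumes "symmetric_poly g" "\<beta> \<noteq> 0"
  shows "order (circle_reflect \<beta>) g = order \<beta> g"
  using order_circle_reflect_le[OF assms] order_circle_reflect_le[OF assms(1), of "circle_reflect \<beta>"] assms(2)
  by (simp add: circle_reflect_def)

section \<open>Cofactors of the roots\<close>

text \<open>Only one linear factor is removed: for nonzero \<open>g\<close>, a root of order m keeps
  order m - 1 in its own cofactor.\<close>

definition cofactor :: "'a::field poly \<Rightarrow> 'a \<Rightarrow> 'a poly" where
  "cofactor g \<beta> = g div [:-\<beta>, 1:]"

lemma linear_mult_cofactor:
  "poly g \<beta> = 0 \<Longrightarrow> [:-\<beta>, 1:] * cofactor g \<beta> = g"
  unfolding cofactor_def by (simp only: poly_eq_0_iff_dvd dvd_mult_div_cancel)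

lemma degree_eq_sum_order:
  fixes g :: "complex poly"
  assumes "g \<noteq> 0"
  shows "degree g = (\<Sum>\<beta> | poly g \<beta> = 0. order \<beta> g)"
proof -
  have "degree g = degree (smult (lead_coeff g) (\<Prod>\<beta> | poly g \<beta> = 0. [:-\<beta>, 1:] ^ order \<beta> g))"
    by (simp only: complex_poly_decompose)
  also have "\<dots> = degree (\<Prod>\<beta> | poly g \<beta> = 0. [:-\<beta>, 1:] ^ order \<beta> g)"
    using assms by simp
  also have "\<dots> = (\<Sum>\<beta> | poly g \<beta> = 0. degree ([:-\<beta>, 1:] ^ order \<beta> g))"
    by (rule degree_prod_eq_sum_degree) simp
  finally show ?thesis by (simp add: degree_power_eq)
qed

text \<open>The logarithmic derivative of \<open>g\<close>, multiplied by \<open>g\<close>. Each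
  term of the product rule for the linear factorization is matched with one cofactor.\<close>

lemma pderiv_eq_sum_cofactor:
  fixes g :: "complex poly"
  assumes "g \<noteq> 0"
  shows "pderiv g = (\<Sum>\<beta> | poly g \<beta> = 0. smult (of_nat (order \<beta> g)) (cofactor g \<beta>))"
proof -
  define R where "R = {\<beta>. poly g \<beta> = 0}"
  have fin: "finite R" using assms by (simp add: R_def poly_roots_finite)
  define F where "F = (\<lambda>\<beta>. [:-\<beta>, 1:] ^ order \<beta> g)"
  have g: "g = smult (lead_coeff g) (\<Prod>\<beta>\<in>R. F \<beta>)"
    unfolding R_def F_def by (simp only: complex_poly_decompose)
  have "smult (lead_coeff g) ((\<Prod>\<alpha>\<in>R - {\<beta>}. F \<alpha>) * pderiv (F \<beta>))
        = smult (of_nat (order \<beta> g)) (cofactor g \<beta>)" if \<beta>: "\<beta> \<in> R" for \<beta>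
  proof -
    have "order \<beta> g \<noteq> 0" using \<beta> assms by (simp add: R_def order_root)
    then obtain m where m: "order \<beta> g = Suc m" by (metis not0_implies_Suc)
    have "[:-\<beta>, 1:] * cofactor g \<beta> = smult (lead_coeff g) (F \<beta> * (\<Prod>\<alpha>\<in>R - {\<beta>}. F \<alpha>))"
    proof -
      have "[:-\<beta>, 1:] * cofactor g \<beta> = g" using \<beta> by (simp only: R_def mem_Collect_eq linear_mult_cofactor)
      then show ?thesis using prod.remove[OF fin \<beta>, of F] g by metis
    qed
    also have "\<dots> = [:-\<beta>, 1:] * smult (lead_coeff g) ([:-\<beta>, 1:] ^ m * (\<Prod>\<alpha>\<in>R - {\<beta>}. F \<alpha>))"
      by (simp only: F_def m power_Suc mult_smult_right mult.assoc)
    finally have "cofactor g \<beta> = smult (lead_coeff g) ([:-\<beta>, 1:] ^ m * (\<Prod>\<alpha>\<in>R - {\<beta>}. F \<alpha>))"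
      by (subst (asm) mult_left_cancel) auto
    moreover have "pderiv (F \<beta>) = smult (of_nat (order \<beta> g)) ([:-\<beta>, 1:] ^ m)"
      by (simp only: F_def m pderiv_power_Suc) (simp add: pderiv_pCons)
    ultimately show ?thesis by (simp add: mult.commute)
  qed
  moreover have "pderiv g = (\<Sum>\<beta>\<in>R. smult (lead_coeff g) ((\<Prod>\<alpha>\<in>R - {\<beta>}. F \<alpha>) * pderiv (F \<beta>)))"
  proof -
    have "pderiv g = smult (lead_coeff g) (pderiv (\<Prod>\<beta>\<in>R. F \<beta>))"
      by (subst g) (rule pderiv_smult)
    also have "\<dots> = [:lead_coeff g:] * (\<Sum>\<beta>\<in>R. (\<Prod>\<alpha>\<in>R - {\<beta>}. F \<alpha>) * pderiv (F \<beta>))"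
      by (simp add: pderiv_prod)
    finally show ?thesis by (simp only: sum_distrib_left) simp
  qed
  ultimately show ?thesis by (simp add: R_def)
qed

text \<open>Every other cofactor keeps the full power of x - \<gamma> found in \<open>g\<close>. If
  \<open>a \<gamma>\<close> were nonzero, the cofactor at \<gamma> would also contain that power,
  and \<open>g\<close> one power more than its order allows.\<close>

lemma cofactors_independent:
  fixes g :: "complex poly"
  assumes "g \<noteq> 0" "(\<Sum>\<beta> | poly g \<beta> = 0. smult (a \<beta>) (cofactor g \<beta>)) = 0" "poly g \<gamma> = 0"
  shows "a \<gamma> = 0"
proof (rule ccontr)
  assume a: "a \<gamma> \<noteq> 0"
  define R where "R = {\<beta>. poly g \<beta> = 0}"
  have fin: "finite R" using assms by (simp add: R_def poly_roots_finite)
  have "smult (a \<gamma>) (cofactor g \<gamma>) + (\<Sum>\<beta>\<in>R - {\<gamma>}. smult (a \<beta>) (cofactor g \<beta>)) = 0"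
    using assms(2,3) sum.remove[OF fin, of \<gamma> "\<lambda>\<beta>. smult (a \<beta>) (cofactor g \<beta>)"]
    by (simp add: R_def)
  then have *: "smult (a \<gamma>) (cofactor g \<gamma>) = - (\<Sum>\<beta>\<in>R - {\<gamma>}. smult (a \<beta>) (cofactor g \<beta>))"
    by (simp add: eq_neg_iff_add_eq_0)
  have "[:-\<gamma>, 1:] ^ order \<gamma> g dvd cofactor g \<beta>" if "\<beta> \<in> R - {\<gamma>}" for \<beta>
  proof -
    have "g = [:-\<beta>, 1:] * cofactor g \<beta>"
      using that linear_mult_cofactor[of g \<beta>] by (simp only: R_def Diff_iff mem_Collect_eq)
    moreover from this have "order \<gamma> g = order \<gamma> [:-\<beta>, 1:] + order \<gamma> (cofactor g \<beta>)"
      using assms(1) order_mult by metis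
    moreover have "order \<gamma> [:-\<beta>, 1:] = 0" using that by (intro order_0I) auto
    ultimately show ?thesis using order_1[of \<gamma> "cofactor g \<beta>"] by simp
  qed
  then have "[:-\<gamma>, 1:] ^ order \<gamma> g dvd smult (a \<gamma>) (cofactor g \<gamma>)"
    unfolding * by (auto intro!: dvd_sum dvd_smult)
  then have dvd: "[:-\<gamma>, 1:] ^ order \<gamma> g dvd cofactor g \<gamma>"
    using a by (simp add: dvd_smult_iff)
  have g: "g = [:-\<gamma>, 1:] * cofactor g \<gamma>" by (rule linear_mult_cofactor[OF assms(3), symmetric])
  then have "[:-\<gamma>, 1:] ^ Suc (order \<gamma> g) dvd g"
    using dvd by (metis mult_dvd_mono dvd_refl power_Suc)
  then show False using order_2 assms(1) by blast
qed

lemma degree_cofactor: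
  assumes "g \<noteq> 0" "poly g \<beta> = 0"
  shows "degree g = Suc (degree (cofactor g \<beta>))"
proof -
  have "cofactor g \<beta> \<noteq> 0" using linear_mult_cofactor[of g \<beta>] assms by auto
  then have "degree ([:-\<beta>, 1:] * cofactor g \<beta>) = Suc (degree (cofactor g \<beta>))"
    by (subst degree_mult_eq) auto
  then show ?thesis by (simp only: linear_mult_cofactor[OF assms(2)])
qed

text \<open>Unit vectors read off the coefficients below \<open>degree g\<close>. Cofactors have
  smaller degree, so the whole polynomial combination vanishes.\<close>

lemma cofactor_forms_independent:
  fixes g :: "complex poly"
  assumes "g \<noteq> 0"
    and "\<And>z. (\<Sum>\<beta> | poly g \<beta> = 0. a \<beta> * lin_form (degree g) (coeff (cofactor g \<beta>)) z) = 0"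
  shows "\<forall>\<beta>\<in>{\<beta>. poly g \<beta> = 0}. a \<beta> = 0"
proof -
  have "coeff (\<Sum>\<beta> | poly g \<beta> = 0. smult (a \<beta>) (cofactor g \<beta>)) i = 0" for i
  proof (cases "i < degree g")
    case True
    have "lin_form (degree g) l (\<lambda>k. of_bool (k = i)) = l i" for l
      using True by (simp add: lin_form_def of_bool_def if_distrib cong: if_cong)
    with assms(2)[of "\<lambda>k. of_bool (k = i)"] show ?thesis by (simp add: coeff_sum)
  next
    case False
    then have "coeff (cofactor g \<beta>) i = 0" if "poly g \<beta> = 0" for \<beta>
      using degree_cofactor[OF assms(1) that] by (intro coeff_eq_0) simp
    then show ?thesis by (simp add: coeff_sum)
  qed
  then have "(\<Sum>\<beta> | poly g \<beta> = 0. smult (a \<beta>) (cofactor g \<beta>)) = 0"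
    by (intro poly_eqI) simp
  then show ?thesis using cofactors_independent[OF assms(1)] by blast
qed

text \<open>Since the degree is the sum of the orders m and g = (x - \<beta>) L for each root, the
  \<beta>-term is L times m/2 (x - \<beta>) - m x = -m/2 (x + \<beta>).\<close>

lemma delta_poly_eq_sum_cofactor:
  assumes "g \<noteq> 0"
  shows "delta_poly g
    = (\<Sum>\<beta> | poly g \<beta> = 0. smult (- of_nat (order \<beta> g) / 2) ([:\<beta>, 1:] * cofactor g \<beta>))"
proof -
  have "smult (of_nat (degree g) / 2) g
      = (\<Sum>\<beta> | poly g \<beta> = 0. smult (of_nat (order \<beta> g) / 2) ([:-\<beta>, 1:] * cofactor g \<beta>))"
  proof -
    have "smult (of_nat (degree g) / 2) g = (\<Sum>\<beta> | poly g \<beta> = 0. smult (of_nat (order \<beta> g) / 2) g)"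
      by (simp add: degree_eq_sum_order[OF assms] smult_sum sum_divide_distrib)
    then show ?thesis by (simp add: linear_mult_cofactor del: mult_pCons_left)
  qed
  then have "delta_poly g = (\<Sum>\<beta> | poly g \<beta> = 0.
      smult (of_nat (order \<beta> g) / 2) ([:-\<beta>, 1:] * cofactor g \<beta>)
      - [:0, 1:] * smult (of_nat (order \<beta> g)) (cofactor g \<beta>))"
    by (simp only: delta_poly_def pderiv_eq_sum_cofactor[OF assms] sum_distrib_left sum_subtractf)
  also have "\<dots> = (\<Sum>\<beta> | poly g \<beta> = 0. smult (- of_nat (order \<beta> g) / 2) ([:\<beta>, 1:] * cofactor g \<beta>))"
  proof (rule sum.cong[OF refl])
    fix \<beta>
    have "poly (smult (of_nat (order \<beta> g) / 2) ([:-\<beta>, 1:] * cofactor g \<beta>)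
      - [:0, 1:] * smult (of_nat (order \<beta> g)) (cofactor g \<beta>)) t
      = poly (smult (- of_nat (order \<beta> g) / 2) ([:\<beta>, 1:] * cofactor g \<beta>)) t" for t
      by (simp add: field_simps)
    then show "smult (of_nat (order \<beta> g) / 2) ([:-\<beta>, 1:] * cofactor g \<beta>)
      - [:0, 1:] * smult (of_nat (order \<beta> g)) (cofactor g \<beta>)
      = smult (- of_nat (order \<beta> g) / 2) ([:\<beta>, 1:] * cofactor g \<beta>)"
      by (rule poly_eq_poly_eq_iff[THEN iffD1, OF ext])
  qed
  finally show ?thesis .
qed

lemma symmetric_poly_root_nonzero:
  "symmetric_poly g \<Longrightarrow> poly g \<beta> = 0 \<Longrightarrow> \<beta> \<noteq> 0"
  using symmetric_poly_coeff_0 by (auto simp: poly_0_coeff_0)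

lemma symmetric_poly_root_reflect:
  assumes "symmetric_poly g" "poly g \<beta> = 0"
  shows "poly g (circle_reflect \<beta>) = 0"
  using order_circle_reflect[OF assms(1) symmetric_poly_root_nonzero[OF assms]] assms
  by (metis order_root symmetric_poly_def)

lemma bij_betw_circle_reflect_roots:
  assumes "symmetric_poly g"
  shows "bij_betw circle_reflect {\<beta>. poly g \<beta> = 0} {\<beta>. poly g \<beta> = 0}"
  by (rule bij_betw_byWitness[where f' = circle_reflect])
     (auto simp: symmetric_poly_root_reflect[OF assms])

section \<open>The form as a sum over the roots\<close>

text \<open>Once the conjugated sum is reindexed, each summand of the numerator is divisible by 1 -
  x y on its own, because (x - \<beta>)(y + 1/\<beta>) + (x + \<beta>)(y - 1/\<beta>) = -2 (1 - x
  y).\<close>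

lemma K_quotient_eq:
  assumes "symmetric_poly g"
  shows "K_quotient g = (\<Sum>\<beta> | poly g \<beta> = 0.
    in_x (smult (of_nat (order \<beta> g)) (cofactor g \<beta>)) *
    in_y (conj_poly (cofactor g (circle_reflect \<beta>))))"
    (is "_ = ?K")
proof -
  define R where "R = {\<beta>. poly g \<beta> = 0}"
  have g0: "g \<noteq> 0" using assms by (simp add: symmetric_poly_def)
  \<comment> \<open>For a root \<beta>, \<open>G \<beta>\<close> is the conjugate of
    \<open>g\<close> divided by y - 1/\<beta>, as the conjugate of \<beta>* is 1/\<beta>.\<close>
  define G where "G = (\<lambda>\<beta>. conj_poly (cofactor g (circle_reflect \<beta>)))"
  have nz: "\<beta> \<noteq> 0" if "\<beta> \<in> R" for \<beta>
    using that symmetric_poly_root_nonzero[OF assms] by (simp add: R_def)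
  have conj_delta: "conj_poly (delta_poly g)
     = (\<Sum>\<beta>\<in>R. smult (- of_nat (order \<beta> g) / 2) ([:1 / \<beta>, 1:] * G \<beta>))"
  proof -
    have "conj_poly (delta_poly g) = (\<Sum>\<beta>\<in>R. smult (- of_nat (order \<beta> g) / 2)
        ([:cnj \<beta>, 1:] * conj_poly (cofactor g \<beta>)))"
      by (simp add: delta_poly_eq_sum_cofactor[OF g0] R_def conj_poly_sum conj_poly_smult
          conj_poly_mult conj_poly_pCons del: mult_pCons_left smult_minus_left)
    also have "\<dots> = (\<Sum>\<beta>\<in>R. smult (- of_nat (order (circle_reflect \<beta>) g) / 2)
        ([:cnj (circle_reflect \<beta>), 1:] * conj_poly (cofactor g (circle_reflect \<beta>))))"
      unfolding R_def by (rule sum.reindex_bij_betw[symmetric, OF bij_betw_circle_reflect_roots[OF assms]])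
    also have "\<dots> = (\<Sum>\<beta>\<in>R. smult (- of_nat (order \<beta> g) / 2) ([:1 / \<beta>, 1:] * G \<beta>))"
      by (intro sum.cong refl)
        (simp only: order_circle_reflect[OF assms nz], simp add: G_def circle_reflect_def)
    finally show ?thesis .
  qed
  have conj_g: "conj_poly g = [:- (1 / \<beta>), 1:] * G \<beta>" if "\<beta> \<in> R" for \<beta>
  proof -
    have "poly g (circle_reflect \<beta>) = 0"
      using that symmetric_poly_root_reflect[OF assms] by (simp add: R_def)
    from linear_mult_cofactor[OF this]
    have "conj_poly g = conj_poly ([:-circle_reflect \<beta>, 1:] * cofactor g (circle_reflect \<beta>))"
      by (simp only:)
    then show ?thesis
      unfolding conj_poly_mult G_def by (simp add: conj_poly_pCons circle_reflect_def)
  qed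
  define N where "N = in_x g * in_y (conj_poly (delta_poly g)) + in_x (delta_poly g) * in_y (conj_poly g)"
  define D where "D = 1 - in_x [:0, 1:] * in_y [:0, 1:]"
  have "N = (\<Sum>\<beta>\<in>R. in_x g * in_y (smult (- of_nat (order \<beta> g) / 2) ([:1 / \<beta>, 1:] * G \<beta>))
     + in_x (smult (- of_nat (order \<beta> g) / 2) ([:\<beta>, 1:] * cofactor g \<beta>)) * in_y (conj_poly g))"
    unfolding N_def conj_delta
    unfolding delta_poly_eq_sum_cofactor[OF g0] R_def[symmetric]
      in_x_sum in_y_sum sum_distrib_left sum_distrib_right sum.distrib ..
  also have "\<dots> = (\<Sum>\<beta>\<in>R. in_x (smult (of_nat (order \<beta> g)) (cofactor g \<beta>)) * in_y (G \<beta>) * D)"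
  proof (rule sum.cong[OF refl])
    fix \<beta> assume \<beta>: "\<beta> \<in> R"
    define m :: complex where "m = - of_nat (order \<beta> g) / 2"
    have m: "of_nat (order \<beta> g) = - 2 * m" by (simp add: m_def)
    have g: "[:-\<beta>, 1:] * cofactor g \<beta> = g" using \<beta> by (simp only: R_def mem_Collect_eq linear_mult_cofactor)
    \<comment> \<open>The common factor is extracted by splitting off x - \<beta> from
      \<open>g\<close> in the first product and y - 1/\<beta> from its conjugate in the
      second.\<close>
    have "in_x g * in_y (smult m ([:1 / \<beta>, 1:] * G \<beta>))
        + in_x (smult m ([:\<beta>, 1:] * cofactor g \<beta>)) * in_y (conj_poly g)
      = in_x (cofactor g \<beta>) * in_y (G \<beta>) *
        (in_x [:-\<beta>, 1:] * in_y (smult m [:1 / \<beta>, 1:])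
         + in_x (smult m [:\<beta>, 1:]) * in_y [:- (1 / \<beta>), 1:])"
      unfolding conj_g[OF \<beta>] mult_smult_left[symmetric]
      by (subst (1) g[symmetric]) (simp only: in_x_mult in_y_mult distrib_left ac_simps)
    also have "in_x [:-\<beta>, 1:] * in_y (smult m [:1 / \<beta>, 1:])
         + in_x (smult m [:\<beta>, 1:]) * in_y [:- (1 / \<beta>), 1:] = in_x [:- 2 * m:] * D"
      using nz[OF \<beta>] by (simp add: in_x_def in_y_def D_def map_poly_pCons one_pCons)
    finally show "in_x g * in_y (smult (- of_nat (order \<beta> g) / 2) ([:1 / \<beta>, 1:] * G \<beta>))
        + in_x (smult (- of_nat (order \<beta> g) / 2) ([:\<beta>, 1:] * cofactor g \<beta>)) * in_y (conj_poly g)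
      = in_x (smult (of_nat (order \<beta> g)) (cofactor g \<beta>)) * in_y (G \<beta>) * D"
      unfolding m_def[symmetric] m by (simp add: in_x_def ac_simps)
  qed
  also have "\<dots> = ?K * D" by (simp add: G_def R_def sum_distrib_right)
  finally have "N = ?K * D" .
  moreover have "D \<noteq> 0"
  proof -
    have "coeff D 0 = 1" by (simp add: D_def in_x_def in_y_def map_poly_pCons)
    then show ?thesis by auto
  qed
  ultimately show ?thesis by (simp add: K_quotient_def N_def[symmetric] D_def[symmetric])
qed

lemma K_form_eq:
  assumes "symmetric_poly g"
  shows "K_form g z = (\<Sum>\<beta> | poly g \<beta> = 0. of_nat (order \<beta> g)
    * lin_form (degree g) (coeff (cofactor g \<beta>)) z
    * cnj (lin_form (degree g) (coeff (cofactor g (circle_reflect \<beta>))) z))"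
  unfolding K_form_def K_quotient_eq[OF assms] by (rule herm_form_sum_rank_one)

lemma bij_betw_circle_reflect_inside_outside:
  assumes "symmetric_poly g"
  shows "bij_betw circle_reflect {\<beta>. poly g \<beta> = 0 \<and> cmod \<beta> < 1} {\<beta>. poly g \<beta> = 0 \<and> cmod \<beta> > 1}"
proof (rule bij_betw_byWitness[where f' = circle_reflect])
  have "cmod (circle_reflect \<beta>) > 1" if "poly g \<beta> = 0" "cmod \<beta> < 1" for \<beta>
    using that symmetric_poly_root_nonzero[OF assms] by (simp add: cmod_circle_reflect)
  then show "circle_reflect ` {\<beta>. poly g \<beta> = 0 \<and> cmod \<beta> < 1} \<subseteq> {\<beta>. poly g \<beta> = 0 \<and> cmod \<beta> > 1}"
    using symmetric_poly_root_reflect[OF assms] by auto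
  have "cmod (circle_reflect \<beta>) < 1" if "poly g \<beta> = 0" "cmod \<beta> > 1" for \<beta>
    using that symmetric_poly_root_nonzero[OF assms] by (simp add: cmod_circle_reflect)
  then show "circle_reflect ` {\<beta>. poly g \<beta> = 0 \<and> cmod \<beta> > 1} \<subseteq> {\<beta>. poly g \<beta> = 0 \<and> cmod \<beta> < 1}"
    using symmetric_poly_root_reflect[OF assms] by auto
qed auto

text \<open>Every root outside the disc is the reflection of exactly one inside, so sums can be
  compared pair by pair.\<close>

lemma sum_roots_split:
  fixes h :: "complex \<Rightarrow> 'a::comm_monoid_add"
  assumes "symmetric_poly g"
  shows "(\<Sum>\<beta> | poly g \<beta> = 0. h \<beta>) = (\<Sum>\<beta> | poly g \<beta> = 0 \<and> cmod \<beta> = 1. h \<beta>)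
    + (\<Sum>\<beta> | poly g \<beta> = 0 \<and> cmod \<beta> < 1. h \<beta> + h (circle_reflect \<beta>))"
proof -
  have fin: "finite {\<beta>. poly g \<beta> = 0}"
    using assms by (simp add: symmetric_poly_def poly_roots_finite)
  then have fin': "finite {\<beta>. poly g \<beta> = 0 \<and> P \<beta>}" for P
    by (rule finite_subset[rotated]) auto
  define U where "U = {\<beta>. poly g \<beta> = 0 \<and> cmod \<beta> = 1}"
  define I where "I = {\<beta>. poly g \<beta> = 0 \<and> cmod \<beta> < 1}"
  define E where "E = {\<beta>. poly g \<beta> = 0 \<and> cmod \<beta> > 1}"
  have "{\<beta>. poly g \<beta> = 0} = U \<union> (I \<union> E)"
    by (auto simp: U_def I_def E_def)
  moreover have "sum h (U \<union> (I \<union> E)) = sum h U + sum h (I \<union> E)"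
    unfolding U_def I_def E_def by (rule sum.union_disjoint) (auto simp: fin')
  moreover have "sum h (I \<union> E) = sum h I + sum h E"
    unfolding I_def E_def by (rule sum.union_disjoint) (auto simp: fin')
  ultimately have "(\<Sum>\<beta> | poly g \<beta> = 0. h \<beta>) = sum h U + (sum h I + sum h E)"
    by simp
  also have "sum h E = (\<Sum>\<beta>\<in>I. h (circle_reflect \<beta>))"
    unfolding I_def E_def
    by (rule sum.reindex_bij_betw[symmetric, OF bij_betw_circle_reflect_inside_outside[OF assms]])
  finally show ?thesis by (simp add: sum.distrib U_def I_def)
qed

section \<open>Diagonalization\<close>

text \<open>The difference is taken as \<open>b - a\<close> to match \<open>diag_form\<close> at the
  outer root when \<open>a\<close> belongs to the inner one.\<close>

lemma polarization:
  "a * cnj b + b * cnj a = complex_of_real (((cmod (a + b))\<^sup>2 - (cmod (b - a))\<^sup>2) / 2)"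
  by (simp only: of_real_diff of_real_divide complex_norm_square) (simp add: field_simps)

text \<open>Of each pair \<open>\<beta>, \<beta>*\<close>, the root inside the disc indexes the positive square of the
  polarization identity and the root outside indexes the negative one.\<close>

definition diag_form :: "complex poly \<Rightarrow> complex \<Rightarrow> nat \<Rightarrow> complex" where
  "diag_form g \<beta> = (if cmod \<beta> = 1 then coeff (cofactor g \<beta>)
     else if cmod \<beta> < 1
       then (\<lambda>t. coeff (cofactor g \<beta>) t + coeff (cofactor g (circle_reflect \<beta>)) t)
       else (\<lambda>t. coeff (cofactor g \<beta>) t - coeff (cofactor g (circle_reflect \<beta>)) t))"

text \<open>The halves come from \<open>polarization\<close>. The order of a root scales its weight
  without changing the sign, which is why distinct roots are counted.\<close>

definition diag_weight :: "complex poly \<Rightarrow> complex \<Rightarrow> real" where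
  "diag_weight g \<beta> = (if cmod \<beta> = 1 then 1 else if cmod \<beta> < 1 then 1 / 2 else - (1 / 2))
     * of_nat (order \<beta> g)"

lemma K_form_diagonalization:
  assumes "symmetric_poly g"
  shows "K_form g z = complex_of_real (\<Sum>\<beta> | poly g \<beta> = 0.
    diag_weight g \<beta> * (cmod (lin_form (degree g) (diag_form g \<beta>) z))\<^sup>2)"
proof -
  define L where "L = (\<lambda>\<beta>. lin_form (degree g) (coeff (cofactor g \<beta>)) z)"
  define s where "s = (\<lambda>\<beta>. of_nat (order \<beta> g) * L \<beta> * cnj (L (circle_reflect \<beta>)))"
  define t where "t = (\<lambda>\<beta>. complex_of_real
    (diag_weight g \<beta> * (cmod (lin_form (degree g) (diag_form g \<beta>) z))\<^sup>2))"
  note nz = symmetric_poly_root_nonzero[OF assms]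
  have "s \<beta> = t \<beta>" if "poly g \<beta> = 0" "cmod \<beta> = 1" for \<beta>
  proof -
    have "circle_reflect \<beta> = \<beta>" using that nz by (simp add: circle_reflect_fixed_iff)
    then show ?thesis
      using that by (simp add: s_def t_def diag_weight_def diag_form_def L_def complex_norm_square
          del: of_real_power)
  qed
  \<comment> \<open>Off the circle a single \<open>s \<beta>\<close> need not be real; only the two
    terms of a pair together are compared.\<close>
  moreover have "s \<beta> + s (circle_reflect \<beta>) = t \<beta> + t (circle_reflect \<beta>)"
    if \<beta>: "poly g \<beta> = 0" "cmod \<beta> < 1" for \<beta>
  proof -
    define \<gamma> where "\<gamma> = circle_reflect \<beta>"
    have \<gamma>: "circle_reflect \<gamma> = \<beta>" "order \<gamma> g = order \<beta> g" "cmod \<gamma> > 1"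
      using \<beta> nz by (auto simp: \<gamma>_def order_circle_reflect[OF assms] cmod_circle_reflect)
    have "s \<beta> + s \<gamma> = of_nat (order \<beta> g) * (L \<beta> * cnj (L \<gamma>) + L \<gamma> * cnj (L \<beta>))"
      by (simp add: s_def \<gamma> \<gamma>_def[symmetric] algebra_simps)
    also have "\<dots> = t \<beta> + t \<gamma>"
      unfolding polarization
      using \<beta> \<gamma> by (simp add: t_def diag_weight_def diag_form_def \<gamma>_def[symmetric] L_def
          lin_form_add_left lin_form_diff_left field_simps)
    finally show ?thesis by (simp add: \<gamma>_def)
  qed
  ultimately have "(\<Sum>\<beta> | poly g \<beta> = 0. s \<beta>) = (\<Sum>\<beta> | poly g \<beta> = 0. t \<beta>)"
    unfolding sum_roots_split[OF assms] by simp
  then show ?thesis by (simp add: K_form_eq[OF assms] s_def t_def L_def)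
qed

text \<open>Passing to sums and differences of cofactor forms is an invertible change of basis. The
  dual vectors change by the same sums and differences, halved.\<close>

lemma diag_form_dual_vectors_exist:
  assumes "symmetric_poly g"
  shows "\<exists>f. \<forall>\<alpha>\<in>{\<beta>. poly g \<beta> = 0}. \<forall>\<beta>\<in>{\<beta>. poly g \<beta> = 0}.
    lin_form (degree g) (diag_form g \<beta>) (f \<alpha>) = of_bool (\<alpha> = \<beta>)"
proof -
  define R where "R = {\<beta>. poly g \<beta> = 0}"
  have g0: "g \<noteq> 0" using assms by (simp add: symmetric_poly_def)
  have "\<exists>e. \<forall>\<alpha>\<in>R. \<forall>\<beta>\<in>R. lin_form (degree g) (coeff (cofactor g \<beta>)) (e \<alpha>) = of_bool (\<alpha> = \<beta>)"
    unfolding R_def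
    by (rule dual_vectors_exist[OF poly_roots_finite[OF g0] cofactor_forms_independent[OF g0]])
  then obtain e where e: "\<And>\<alpha> \<beta>. \<alpha> \<in> R \<Longrightarrow> \<beta> \<in> R \<Longrightarrow>
      lin_form (degree g) (coeff (cofactor g \<beta>)) (e \<alpha>) = of_bool (\<alpha> = \<beta>)" by blast
  define f where "f = (\<lambda>\<beta>. if cmod \<beta> = 1 then e \<beta>
     else if cmod \<beta> < 1 then (\<lambda>t. (e \<beta> t + e (circle_reflect \<beta>) t) / 2)
     else (\<lambda>t. (e \<beta> t - e (circle_reflect \<beta>) t) / 2))"
  have "lin_form (degree g) (diag_form g \<beta>) (f \<alpha>) = of_bool (\<alpha> = \<beta>)"
    if R: "\<alpha> \<in> R" "\<beta> \<in> R" for \<alpha> \<beta>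
  proof -
    have R': "circle_reflect \<alpha> \<in> R" "circle_reflect \<beta> \<in> R"
      using R symmetric_poly_root_reflect[OF assms] by (auto simp: R_def)
    have nz: "\<alpha> \<noteq> 0" "\<beta> \<noteq> 0"
      using R symmetric_poly_root_nonzero[OF assms] by (auto simp: R_def)
    have fixed: "circle_reflect \<alpha> = \<alpha> \<longleftrightarrow> cmod \<alpha> = 1" "circle_reflect \<beta> = \<beta> \<longleftrightarrow> cmod \<beta> = 1"
      using nz by (auto simp: circle_reflect_fixed_iff)
    \<comment> \<open>These equivalences decide which of the indices \<alpha>, \<beta> and their
      reflections coincide when the four products are expanded.\<close>
    have inv: "circle_reflect \<alpha> = circle_reflect \<beta> \<longleftrightarrow> \<alpha> = \<beta>" 
      "circle_reflect \<alpha> = \<beta> \<longleftrightarrow> \<alpha> = circle_reflect \<beta>"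
      by (metis circle_reflect_involution)+
    have "cmod (circle_reflect \<beta>) = 1 \<longleftrightarrow> cmod \<beta> = 1"
      "cmod (circle_reflect \<beta>) < 1 \<longleftrightarrow> cmod \<beta> > 1"
      "cmod (circle_reflect \<beta>) > 1 \<longleftrightarrow> cmod \<beta> < 1"
      using nz by (auto simp: cmod_circle_reflect)
    then show ?thesis
      using fixed inv
      by (auto simp: diag_form_def f_def lin_form_add_left lin_form_diff_left lin_form_divide_right
          lin_form_add_right lin_form_diff_right e R R' of_bool_def)
  qed
  then show ?thesis unfolding R_def by blast
qed

section \<open>Counting the roots from the signature\<close>

theorem theorem2:
  fixes g :: "complex poly" and n \<pi> \<nu> :: nat
  assumes "degree g = n" and "n \<ge> 1" and "symmetric_poly g"
    and "has_squared_terms n (K_form g) \<pi> \<nu>"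
  shows "int (card {z. poly g z = 0 \<and> cmod z = 1}) = int \<pi> - int \<nu>
       \<and> card {{\<beta>, circle_reflect \<beta>} | \<beta>.
            poly g \<beta> = 0 \<and> poly g (circle_reflect \<beta>) = 0 \<and> cmod \<beta> \<noteq> 1} = \<nu>"
proof -
  note sym = assms(3)
  define R where "R = {\<beta>. poly g \<beta> = 0}"
  define U where "U = {\<beta>. poly g \<beta> = 0 \<and> cmod \<beta> = 1}"
  define I where "I = {\<beta>. poly g \<beta> = 0 \<and> cmod \<beta> < 1}"
  define E where "E = {\<beta>. poly g \<beta> = 0 \<and> cmod \<beta> > 1}"
  have g0: "g \<noteq> 0" using sym by (simp add: symmetric_poly_def)
  have finR: "finite R" using g0 by (simp add: R_def poly_roots_finite)
  then have fin: "finite U" "finite I"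
    by (auto simp: R_def U_def I_def elim!: rev_finite_subset)
  from assms(4) obtain m and c :: "nat \<Rightarrow> real" and l where
    indep: "lin_indep_forms n m l" and
    K: "\<And>z. K_form g z = complex_of_real (\<Sum>j<m. c j * (cmod (lin_form n (l j) z))\<^sup>2)" and
    pos: "card {j. j < m \<and> c j > 0} = \<pi>" and neg: "card {j. j < m \<and> c j < 0} = \<nu>"
    unfolding has_squared_terms_def by blast
  have "\<exists>e. \<forall>i\<in>{..<m}. \<forall>j\<in>{..<m}. lin_form n (l j) (e i) = of_bool (i = j)"
    using indep by (intro dual_vectors_exist) (auto simp: lin_indep_forms_def)
  then obtain e where e: "\<And>i j. i \<in> {..<m} \<Longrightarrow> j \<in> {..<m} \<Longrightarrow> lin_form n (l j) (e i) = of_bool (i = j)"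
    by blast
  obtain f where f: "\<And>\<alpha> \<beta>. \<alpha> \<in> R \<Longrightarrow> \<beta> \<in> R \<Longrightarrow>
      lin_form n (diag_form g \<beta>) (f \<alpha>) = of_bool (\<alpha> = \<beta>)"
    using diag_form_dual_vectors_exist[OF sym] assms(1) unfolding R_def by blast
  have eq: "(\<Sum>j<m. c j * (cmod (lin_form n (l j) z))\<^sup>2)
      = (\<Sum>\<beta>\<in>R. diag_weight g \<beta> * (cmod (lin_form n (diag_form g \<beta>) z))\<^sup>2)" for z
    using K[of z] K_form_diagonalization[OF sym, of z] assms(1) unfolding R_def
    by (metis of_real_eq_iff)
  have order_pos: "order \<beta> g > 0" if "\<beta> \<in> R" for \<beta>
    using that g0 by (simp add: R_def order_root)
  \<comment> \<open>Roots on the circle and inside it carry the positive squares, those outside the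
    negative ones; reflection then cancels \<open>I\<close> against \<open>E\<close> in the
    difference.\<close>
  have "{\<beta>\<in>R. diag_weight g \<beta> > 0} = U \<union> I" "{\<beta>\<in>R. diag_weight g \<beta> < 0} = E"
    using order_pos
    by (auto simp: R_def U_def I_def E_def diag_weight_def zero_less_mult_iff mult_less_0_iff
        split: if_splits)
  with law_of_inertia[OF finite_lessThan finR e f eq] pos neg
  have "\<pi> = card (U \<union> I)" "\<nu> = card E" by simp_all
  moreover have "card (U \<union> I) = card U + card I"
    using fin by (intro card_Un_disjoint) (auto simp: U_def I_def)
  moreover have "card E = card I"
    using bij_betw_same_card[OF bij_betw_circle_reflect_inside_outside[OF sym]]
    by (simp add: I_def E_def)
  moreover have "card {{\<beta>, circle_reflect \<beta>} | \<beta>.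
      poly g \<beta> = 0 \<and> poly g (circle_reflect \<beta>) = 0 \<and> cmod \<beta> \<noteq> 1} = card I"
  proof -
    note bij = bij_betw_circle_reflect_inside_outside[OF sym, folded I_def E_def]
    \<comment> \<open>Each unordered pair is represented by its member inside the disc.\<close>
    have "{{\<beta>, circle_reflect \<beta>} | \<beta>.
        poly g \<beta> = 0 \<and> poly g (circle_reflect \<beta>) = 0 \<and> cmod \<beta> \<noteq> 1}
      = (\<lambda>\<beta>. {\<beta>, circle_reflect \<beta>}) ` I" (is "?P = _")
    proof
      show "?P \<subseteq> (\<lambda>\<beta>. {\<beta>, circle_reflect \<beta>}) ` I"
      proof
        fix X assume "X \<in> ?P"
        then obtain \<beta> where X: "X = {\<beta>, circle_reflect \<beta>}" and \<beta>: "poly g \<beta> = 0" "cmod \<beta> \<noteq> 1"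
          by blast
        show "X \<in> (\<lambda>\<beta>. {\<beta>, circle_reflect \<beta>}) ` I"
        proof (cases "cmod \<beta> < 1")
          case True
          then show ?thesis using X \<beta> by (auto simp: I_def)
        next
          case False
          with \<beta> have "\<beta> \<in> E" by (simp add: E_def)
          then obtain \<gamma> where "\<gamma> \<in> I" "\<beta> = circle_reflect \<gamma>"
            using bij by (auto simp: bij_betw_def)
          then show ?thesis using X by (auto simp: insert_commute)
        qed
      qed
      show "(\<lambda>\<beta>. {\<beta>, circle_reflect \<beta>}) ` I \<subseteq> ?P"
        using symmetric_poly_root_reflect[OF sym] by (auto simp: I_def)
    qed
    moreover have "inj_on (\<lambda>\<beta>. {\<beta>, circle_reflect \<beta>}) I"
    proof (rule inj_onI)
      fix \<alpha> \<beta> assume "\<alpha> \<in> I" "\<beta> \<in> I" and eq: "{\<alpha>, circle_reflect \<alpha>} = {\<beta>, circle_reflect \<beta>}"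
      \<comment> \<open>The reflection of \<beta> lies outside the disc, so \<beta> is the only
        element of its pair that the inner root \<alpha> can equal.\<close>
      then have "circle_reflect \<beta> \<in> E" using bij by (auto simp: bij_betw_def)
      with \<open>\<alpha> \<in> I\<close> have "\<alpha> \<noteq> circle_reflect \<beta>" by (auto simp: I_def E_def)
      with eq show "\<alpha> = \<beta>" by blast
    qed
    ultimately show ?thesis by (simp add: card_image)
  qed
  ultimately show ?thesis by (simp add: U_def)
qed

end
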